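(* For a ring $R$ with identity, the following statements are equivalent: (1) The set of units $\mathrm{U}(R)$ is a paragon in $\mathrm{T}(R)$ and $\mathrm{T}(R)/\mathrm{U}(R)\cong\mathrm{T}(\mathbb{Z}_2)$ as trusses. (2) For all $r\in R$, exactly one of the statements $r\in\mathrm{U}(R)$ and $1-r\in\mathrm{U}(R)$ holds.
   Context: For a ring $R$, the associated truss $\mathrm{T}(R)$ is the set $R$ with the ternary operation $[a,b,c]=a-b+c$ and the multiplication of $R$. $\mathrm{U}(R)$ is the set of (two-sided) multiplicatively invertible elements of $R$. A sub-heap is a subset closed under $[-,-,-]$. A paragon in $\mathrm{T}(R)$ is a sub-heap $P\subseteq R$ for which there exists $q\in P$ such that, for all $x\in R$ and $p\in P$, $[xp,xq,q]\in P$ and $[px,qx,q]\in P$. For a paragon $P$, the relation $x\sim_P y\iff\exists\,p\in P,\ [x,y,p]\in P$ is an equivalence relation compatible with the ternary operation and the multiplication, and $\mathrm{T}(R)/P$ denotes the quotient truss (the set of classes with the induced operations). A truss isomorphism is a bijection preserving the ternary operation and the multiplication. *)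

theory Defs
  imports "HOL-Algebra.Algebra" "HOL-Number_Theory.Residues"
begin

record 'a truss = "'a partial_object" +
  heap_op :: "'a \<Rightarrow> 'a \<Rightarrow> 'a \<Rightarrow> 'a"
  truss_mult :: "'a \<Rightarrow> 'a \<Rightarrow> 'a"

definition ring_truss :: "('a, 'm) ring_scheme \<Rightarrow> 'a truss"
  where "ring_truss R =
    \<lparr> carrier = carrier R,
      heap_op = (\<lambda>a b c. a \<ominus>\<^bsub>R\<^esub> b \<oplus>\<^bsub>R\<^esub> c),
      truss_mult = (\<lambda>a b. a \<otimes>\<^bsub>R\<^esub> b) \<rparr>"

definition sub_heap :: "('a, 'm) truss_scheme \<Rightarrow> 'a set \<Rightarrow> bool"
  where "sub_heap T P \<longleftrightarrow>
    P \<subseteq> carrier T \<and> (\<forall>a\<in>P. \<forall>b\<in>P. \<forall>c\<in>P. heap_op T a b c \<in> P)"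

definition paragon :: "('a, 'm) truss_scheme \<Rightarrow> 'a set \<Rightarrow> bool"
  where "paragon T P \<longleftrightarrow>
    sub_heap T P \<and>
    (\<exists>q\<in>P. \<forall>x\<in>carrier T. \<forall>p\<in>P.
       heap_op T (truss_mult T x p) (truss_mult T x q) q \<in> P \<and>
       heap_op T (truss_mult T p x) (truss_mult T q x) q \<in> P)"

definition paragon_rel :: "('a, 'm) truss_scheme \<Rightarrow> 'a set \<Rightarrow> ('a \<times> 'a) set"
  where "paragon_rel T P =
    {(x, y). x \<in> carrier T \<and> y \<in> carrier T \<and> (\<exists>p\<in>P. heap_op T x y p \<in> P)}"

(* As usual for quotients by an equivalence relation, an operation on classes is
   the union of the classes of its values at all representatives. When P is a
   paragon in T(R) the relation is a congruence, so this union is a single class: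
   the class of the value at any choice of representatives. *)
definition quotient_truss :: "('a, 'm) truss_scheme \<Rightarrow> 'a set \<Rightarrow> 'a set truss"
  where "quotient_truss T P =
    \<lparr> carrier = carrier T // paragon_rel T P,
      heap_op = (\<lambda>A B C. \<Union>a\<in>A. \<Union>b\<in>B. \<Union>c\<in>C. paragon_rel T P `` {heap_op T a b c}),
      truss_mult = (\<lambda>A B. \<Union>a\<in>A. \<Union>b\<in>B. paragon_rel T P `` {truss_mult T a b}) \<rparr>"

definition truss_iso :: "('a, 'm) truss_scheme \<Rightarrow> ('b, 'n) truss_scheme \<Rightarrow> ('a \<Rightarrow> 'b) set"
  where "truss_iso S T =
    {f. bij_betw f (carrier S) (carrier T) \<and>
        (\<forall>a\<in>carrier S. \<forall>b\<in>carrier S. \<forall>c\<in>carrier S.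
           f (heap_op S a b c) = heap_op T (f a) (f b) (f c)) \<and>
        (\<forall>a\<in>carrier S. \<forall>b\<in>carrier S.
           f (truss_mult S a b) = truss_mult T (f a) (f b))}"

definition truss_isomorphic :: "('a, 'm) truss_scheme \<Rightarrow> ('b, 'n) truss_scheme \<Rightarrow> bool"
  where "truss_isomorphic S T \<longleftrightarrow> truss_iso S T \<noteq> {}"

end

theory Submission
  imports Defs
begin

text \<open>
  The condition (2) says that \<open>r \<mapsto> [r \<in> U(R)]\<close> is a ring homomorphism onto \<open>\<int>\<^sub>2\<close>; then \<open>U(R)\<close>
  is its fibre over 1, and the two fibres are the classes of the quotient truss. Conversely, if
  \<open>U(R)\<close> is merely a sub-heap, it is one of the classes of the associated equivalence relation.
  When there are exactly two classes, \<open>r\<close> is a non-unit iff \<open>r \<sim> 0\<close>, i.e. iff \<open>r\<close> is a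
  difference \<open>u - p\<close> of units, which is equivalent to \<open>1 - r = 1 - u + p\<close> being a unit.
\<close>

lemma ring_truss_simps [simp]:
  "carrier (ring_truss R) = carrier R"
  "heap_op (ring_truss R) a b c = a \<ominus>\<^bsub>R\<^esub> b \<oplus>\<^bsub>R\<^esub> c"
  "truss_mult (ring_truss R) a b = a \<otimes>\<^bsub>R\<^esub> b"
  by (simp_all add: ring_truss_def)

lemma quotient_truss_simps:
  "carrier (quotient_truss T P) = carrier T // paragon_rel T P"
  "heap_op (quotient_truss T P) A B C =
    (\<Union>a\<in>A. \<Union>b\<in>B. \<Union>c\<in>C. paragon_rel T P `` {heap_op T a b c})"
  "truss_mult (quotient_truss T P) A B = (\<Union>a\<in>A. \<Union>b\<in>B. paragon_rel T P `` {truss_mult T a b})"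
  by (simp_all add: quotient_truss_def)

lemma paragon_rel_ring_truss_iff:
  "(x, y) \<in> paragon_rel (ring_truss R) P \<longleftrightarrow>
    x \<in> carrier R \<and> y \<in> carrier R \<and> (\<exists>p\<in>P. x \<ominus>\<^bsub>R\<^esub> y \<oplus>\<^bsub>R\<^esub> p \<in> P)"
  by (simp add: paragon_rel_def)

section \<open>Classes of a sub-heap in the additive group of a ring\<close>

context ring
begin

lemma sub_heap_ring_truss_iff:
  "sub_heap (ring_truss R) P \<longleftrightarrow>
    P \<subseteq> carrier R \<and> (\<forall>a\<in>P. \<forall>b\<in>P. \<forall>c\<in>P. a \<ominus> b \<oplus> c \<in> P)"
  by (simp add: sub_heap_def)

text \<open>A nonempty sub-heap is a coset of an additive subgroup, namely the group of differences
  of its elements. The relation is congruence modulo that subgroup.\<close>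

lemma equiv_paragon_rel:
  assumes "sub_heap (ring_truss R) P" "P \<noteq> {}"
  shows "equiv (carrier R) (paragon_rel (ring_truss R) P)"
proof (rule equivI)
  have heap: "a \<ominus> b \<oplus> c \<in> P" if "a \<in> P" "b \<in> P" "c \<in> P" for a b c
    using assms(1) that by (simp add: sub_heap_ring_truss_iff)
  have PR: "P \<subseteq> carrier R"
    using assms(1) by (simp add: sub_heap_ring_truss_iff)
  obtain q where q: "q \<in> P"
    using assms(2) by blast
  show "paragon_rel (ring_truss R) P \<subseteq> carrier R \<times> carrier R"
    by (auto simp: paragon_rel_def)
  show "refl_on (carrier R) (paragon_rel (ring_truss R) P)"
  proof (rule refl_onI)
    fix x assume "x \<in> carrier R"
    moreover from this have "x \<ominus> x \<oplus> q \<in> P"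
      using q PR by (simp add: a_minus_def r_neg subset_iff)
    ultimately show "(x, x) \<in> paragon_rel (ring_truss R) P"
      using q by (auto simp: paragon_rel_ring_truss_iff)
  qed
  show "sym (paragon_rel (ring_truss R) P)"
  proof (rule symI)
    fix x y assume "(x, y) \<in> paragon_rel (ring_truss R) P"
    then obtain p where p: "x \<in> carrier R" "y \<in> carrier R" "p \<in> P" "x \<ominus> y \<oplus> p \<in> P"
      by (auto simp: paragon_rel_ring_truss_iff)
    have "p \<in> carrier R"
      using p PR by blast
    \<comment> \<open>The value \<open>x \<ominus> y \<oplus> p\<close> serves as witness for the
      swapped pair; the old witness \<open>p\<close> is the new value.\<close>
    with p have "y \<ominus> x \<oplus> (x \<ominus> y \<oplus> p) = p"
      unfolding minus_eq by algebra
    with p show "(y, x) \<in> paragon_rel (ring_truss R) P"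
      unfolding paragon_rel_ring_truss_iff by metis
  qed
  show "trans (paragon_rel (ring_truss R) P)"
  proof (rule transI)
    fix x y z
    assume "(x, y) \<in> paragon_rel (ring_truss R) P" "(y, z) \<in> paragon_rel (ring_truss R) P"
    then obtain p q where
      xyz: "x \<in> carrier R" "y \<in> carrier R" "z \<in> carrier R" and
      p: "p \<in> P" "x \<ominus> y \<oplus> p \<in> P" and q: "q \<in> P" "y \<ominus> z \<oplus> q \<in> P"
      by (auto simp: paragon_rel_ring_truss_iff)
    have "p \<in> carrier R" "q \<in> carrier R"
      using p q PR by auto
    \<comment> \<open>Inserting \<open>p\<close> with both signs exhibits the element as a heap
      combination of three members of \<open>P\<close>.\<close>
    with xyz have "x \<ominus> z \<oplus> q = (x \<ominus> y \<oplus> p) \<ominus> p \<oplus> (y \<ominus> z \<oplus> q)"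
      unfolding minus_eq by algebra
    also have "\<dots> \<in> P"
      by (rule heap[OF p(2,1) q(2)])
    finally show "(x, z) \<in> paragon_rel (ring_truss R) P"
      using xyz q by (auto simp: paragon_rel_ring_truss_iff)
  qed
qed

lemma paragon_rel_class_of_mem:
  assumes "sub_heap (ring_truss R) P" "q \<in> P"
  shows "paragon_rel (ring_truss R) P `` {q} = P"
proof -
  have PR: "P \<subseteq> carrier R" and heap: "\<And>a b c. a \<in> P \<Longrightarrow> b \<in> P \<Longrightarrow> c \<in> P \<Longrightarrow> a \<ominus> b \<oplus> c \<in> P"
    using assms(1) by (simp_all add: sub_heap_ring_truss_iff)
  have "y \<in> P" if qy: "(q, y) \<in> paragon_rel (ring_truss R) P" for y
  proof -
    obtain p where p: "y \<in> carrier R" "p \<in> P" "q \<ominus> y \<oplus> p \<in> P"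
      using qy by (auto simp: paragon_rel_ring_truss_iff)
    have "q \<in> carrier R" "p \<in> carrier R"
      using p assms PR by auto
    \<comment> \<open>Solving for \<open>y\<close> writes it as a heap combination of members of
      \<open>P\<close>.\<close>
    with p have "y = p \<ominus> (q \<ominus> y \<oplus> p) \<oplus> q"
      unfolding minus_eq by algebra
    also have "\<dots> \<in> P"
      by (rule heap[OF p(2,3) assms(2)])
    finally show ?thesis .
  qed
  \<comment> \<open>The witness is \<open>y\<close> itself.\<close>
  moreover have "(q, y) \<in> paragon_rel (ring_truss R) P" if "y \<in> P" for y
    unfolding paragon_rel_ring_truss_iff
    using that assms(2) PR heap[OF assms(2) that that] by blast
  ultimately show ?thesis
    by auto
qed

text \<open>The isomorphism with the truss of \<int> mod 2 enters through the number of classes. The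
  units form the class of \<open>\<one>\<close>, so the nonunits must form the class of
  \<open>\<zero>\<close>.\<close>

lemma Units_xor_if_two_classes:
  assumes sh: "sub_heap (ring_truss R) (Units R)"
    and card: "card (carrier R // paragon_rel (ring_truss R) (Units R)) = 2"
    and r: "r \<in> carrier R"
  shows "(r \<in> Units R) \<noteq> (\<one> \<ominus> r \<in> Units R)"
proof -
  let ?E = "paragon_rel (ring_truss R) (Units R)"
  have eq: "equiv (carrier R) ?E"
    using sh Units_one_closed by (intro equiv_paragon_rel) auto
  have cls1: "?E `` {\<one>} = Units R"
    using sh by (intro paragon_rel_class_of_mem) auto
  have in_Units: "x \<in> Units R \<longleftrightarrow> ?E `` {x} = ?E `` {\<one>}" if "x \<in> carrier R" for x
    using that eq cls1 sh
    by (metis equiv_class_self paragon_rel_class_of_mem)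
  \<comment> \<open>An invertible zero would make the ring trivial, leaving a single class.\<close>
  have zero: "\<zero> \<notin> Units R"
  proof
    assume z: "\<zero> \<in> Units R"
    then have "\<zero> \<otimes> inv \<zero> = \<one>"
      by (rule Units_r_inv)
    then have "\<one> = \<zero>"
      using Units_inv_closed[OF z] by simp
    then have "carrier R = {\<zero>}"
      by (rule one_zeroD)
    then have "carrier R // ?E = {?E `` {\<zero>}}"
      by (simp add: quotient_def)
    with card show False
      by simp
  qed
  \<comment> \<open>Otherwise the classes of \<open>r\<close>, \<open>\<zero>\<close> and
    \<open>\<one>\<close> would be three distinct ones.\<close>
  have zero_class: "(r, \<zero>) \<in> ?E" if "r \<notin> Units R"
  proof (rule ccontr)
    assume "(r, \<zero>) \<notin> ?E"
    then have ne: "?E `` {r} \<noteq> ?E `` {\<zero>}"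
      using eq r by (simp add: eq_equiv_class_iff)
    let ?S = "{?E `` {r}, ?E `` {\<zero>}, ?E `` {\<one>}}"
    have "card ?S = 3"
      using ne that zero in_Units[OF r] in_Units[OF zero_closed] by simp
    \<comment> \<open>The quotient is finite because its cardinality is positive.\<close>
    moreover have "card ?S \<le> card (carrier R // ?E)"
      using r card by (intro card_mono) (auto intro: quotientI card_ge_0_finite)
    ultimately show False
      using card by simp
  qed
  show ?thesis
  proof (cases "r \<in> Units R")
    case True
    \<comment> \<open>The unit \<open>r\<close> itself witnesses that
      \<open>\<one> \<ominus> r\<close> lies in the class of \<open>\<zero>\<close>.\<close>
    have "(\<one> \<ominus> r) \<ominus> \<zero> \<oplus> r = \<one>"
      using r unfolding minus_eq by algebra
    then have "(\<one> \<ominus> r, \<zero>) \<in> ?E"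
      using True r unfolding paragon_rel_ring_truss_iff
      by (metis Units_one_closed minus_closed one_closed zero_closed)
    then have "\<one> \<ominus> r \<notin> Units R"
      using zero in_Units r eq
      by (metis equiv_class_eq minus_closed one_closed zero_closed)
    with True show ?thesis
      by simp
  next
    case False
    then obtain p where p: "p \<in> Units R" "r \<ominus> \<zero> \<oplus> p \<in> Units R"
      using zero_class by (auto simp: paragon_rel_ring_truss_iff)
    have "\<one> \<ominus> r = \<one> \<ominus> (r \<ominus> \<zero> \<oplus> p) \<oplus> p"
      using r Units_closed[OF p(1)] unfolding minus_eq by algebra
    also have "\<dots> \<in> Units R"
      using sh p by (simp add: sub_heap_ring_truss_iff)
    finally show ?thesis
      using False by simp
  qed
qed

section \<open>Units under negation and under multiplication by units\<close>

lemma Units_minus_iff: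
  assumes "x \<in> carrier R"
  shows "\<ominus> x \<in> Units R \<longleftrightarrow> x \<in> Units R"
proof -
  have "\<ominus> y \<in> Units R" if "y \<in> Units R" for y
  proof -
    have "\<ominus> y \<otimes> \<ominus> (inv y) = \<one>" "\<ominus> (inv y) \<otimes> \<ominus> y = \<one>"
      using that by (simp_all add: l_minus r_minus Units_closed)
    moreover have "\<ominus> y \<in> carrier R" "\<ominus> (inv y) \<in> carrier R"
      using that by (simp_all add: Units_closed)
    ultimately show ?thesis
      unfolding Units_def mem_Collect_eq by (intro conjI bexI)
  qed
  from this[of x] this[of "\<ominus> x"] show ?thesis
    using minus_minus[OF assms] by metis
qed

lemma Units_mult_left_iff:
  assumes "u \<in> Units R" "x \<in> carrier R"
  shows "u \<otimes> x \<in> Units R \<longleftrightarrow> x \<in> Units R"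
proof
  assume "u \<otimes> x \<in> Units R"
  then have "inv u \<otimes> (u \<otimes> x) \<in> Units R"
    using assms by blast
  then show "x \<in> Units R"
    using assms by (simp add: m_assoc[symmetric] Units_closed)
qed (use assms in blast)

lemma Units_mult_right_iff:
  assumes "u \<in> Units R" "x \<in> carrier R"
  shows "x \<otimes> u \<in> Units R \<longleftrightarrow> x \<in> Units R"
proof
  assume "x \<otimes> u \<in> Units R"
  then have "x \<otimes> u \<otimes> inv u \<in> Units R"
    using assms by blast
  then show "x \<in> Units R"
    using assms by (simp add: m_assoc Units_closed)
qed (use assms in blast)

end

section \<open>Parity in rings where exactly one of \<open>r\<close> and
  \<open>\<one> \<ominus> r\<close> is a unit\<close>

locale complementary_units_ring = ring +
  assumes Units_xor: "r \<in> carrier R \<Longrightarrow> (r \<in> Units R) \<noteq> (\<one> \<ominus> r \<in> Units R)"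
begin

text \<open>Factoring out \<open>u\<close> reduces the claim to \<open>\<one> \<oplus> ?y\<close>,
  which is \<open>\<one>\<close> minus the negative of \<open>?y\<close>; negation does not affect
  invertibility.\<close>

lemma Units_add_unit_iff:
  assumes "u \<in> Units R" "x \<in> carrier R"
  shows "u \<oplus> x \<in> Units R \<longleftrightarrow> x \<notin> Units R"
proof -
  let ?y = "inv u \<otimes> x"
  have [simp]: "u \<in> carrier R" "inv u \<in> carrier R"
    using assms by auto
  have "u \<oplus> x = u \<otimes> (\<one> \<ominus> \<ominus> ?y)"
    using assms by (simp add: minus_eq r_distr m_assoc[symmetric])
  then have "u \<oplus> x \<in> Units R \<longleftrightarrow> \<one> \<ominus> \<ominus> ?y \<in> Units R"
    using assms by (simp add: Units_mult_left_iff)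
  also have "\<dots> \<longleftrightarrow> \<ominus> ?y \<notin> Units R"
    using Units_xor[of "\<ominus> ?y"] assms by auto
  also have "\<dots> \<longleftrightarrow> x \<notin> Units R"
    using assms by (simp add: Units_minus_iff Units_mult_left_iff)
  finally show ?thesis .
qed

text \<open>The indicator of the units is additive modulo 2. If \<open>x\<close> is a nonunit, then
  \<open>\<one> \<ominus> x\<close> is a unit, and the previous lemma decides
  \<open>\<one> \<ominus> (x \<oplus> y)\<close>, hence also its complement
  \<open>x \<oplus> y\<close>.\<close>

lemma Units_add_iff:
  assumes "x \<in> carrier R" "y \<in> carrier R"
  shows "x \<oplus> y \<in> Units R \<longleftrightarrow> (x \<in> Units R) \<noteq> (y \<in> Units R)"
proof (cases "x \<in> Units R")
  case True
  then show ?thesis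
    using Units_add_unit_iff assms by simp
next
  case False
  then have "\<one> \<ominus> x \<in> Units R"
    using Units_xor assms by blast
  then have "\<one> \<ominus> x \<oplus> \<ominus> y \<in> Units R \<longleftrightarrow> y \<notin> Units R"
    using assms by (simp add: Units_add_unit_iff Units_minus_iff)
  moreover have "\<one> \<ominus> x \<oplus> \<ominus> y = \<one> \<ominus> (x \<oplus> y)"
    using assms unfolding minus_eq by algebra
  ultimately show ?thesis
    using False Units_xor[of "x \<oplus> y"] assms by auto
qed

lemma Units_diff_iff:
  assumes "x \<in> carrier R" "y \<in> carrier R"
  shows "x \<ominus> y \<in> Units R \<longleftrightarrow> (x \<in> Units R) \<noteq> (y \<in> Units R)"
  using assms by (simp add: minus_eq Units_add_iff Units_minus_iff)

text \<open>A unit factor can be cancelled on its side. For two nonunits,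
  \<open>(\<one> \<ominus> x) \<otimes> y\<close> is a unit times a nonunit, so
  \<open>x \<otimes> y\<close> is a difference of two nonunits and thus a nonunit.\<close>

lemma Units_mult_iff:
  assumes "x \<in> carrier R" "y \<in> carrier R"
  shows "x \<otimes> y \<in> Units R \<longleftrightarrow> x \<in> Units R \<and> y \<in> Units R"
proof (cases "x \<in> Units R \<or> y \<in> Units R")
  case True
  then show ?thesis
    using assms by (auto simp: Units_mult_left_iff Units_mult_right_iff)
next
  case False
  then have "(\<one> \<ominus> x) \<otimes> y \<notin> Units R"
    using Units_xor[of x] assms by (auto simp: Units_mult_left_iff)
  moreover have "x \<otimes> y = y \<ominus> (\<one> \<ominus> x) \<otimes> y"
    using assms unfolding minus_eq by algebra
  ultimately show ?thesis
    using False assms by (simp add: Units_diff_iff)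
qed

lemma paragon_Units: "paragon (ring_truss R) (Units R)"
  unfolding paragon_def
proof (intro conjI bexI ballI)
  show "sub_heap (ring_truss R) (Units R)"
    by (auto simp: sub_heap_ring_truss_iff Units_add_iff Units_diff_iff Units_closed)
  \<comment> \<open>This fixes \<open>\<one>\<close> as the base point \<open>q\<close>. For a unit
    \<open>p\<close>, \<open>x \<otimes> p\<close> and \<open>x \<otimes> \<one>\<close> have equal
    parity, so their difference is a nonunit and adding \<open>\<one>\<close> gives a unit; likewise
    on the other side.\<close>
  show "\<one> \<in> Units R"
    by (rule Units_one_closed)
qed (simp_all add: Units_add_iff Units_diff_iff Units_mult_iff Units_closed)

section \<open>The quotient by the units and its isomorphism with \<int> mod 2\<close>

text \<open>Adding a unit flips parity, so every unit \<open>p\<close> is a witness exactly when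
  \<open>x \<ominus> y\<close> is a nonunit, that is, when the parities agree.\<close>

lemma paragon_rel_Units_iff:
  "(x, y) \<in> paragon_rel (ring_truss R) (Units R) \<longleftrightarrow>
    x \<in> carrier R \<and> y \<in> carrier R \<and> (x \<in> Units R \<longleftrightarrow> y \<in> Units R)"
proof -
  have "(\<exists>p\<in>Units R. x \<ominus> y \<oplus> p \<in> Units R) \<longleftrightarrow> (x \<in> Units R \<longleftrightarrow> y \<in> Units R)"
    if "x \<in> carrier R" "y \<in> carrier R"
    using that Units_one_closed by (auto simp: Units_add_iff Units_diff_iff Units_closed)
  then show ?thesis
    by (auto simp: paragon_rel_ring_truss_iff)
qed

lemma paragon_rel_Units_class:
  assumes "x \<in> carrier R"
  shows "paragon_rel (ring_truss R) (Units R) `` {x} =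
    (if x \<in> Units R then Units R else carrier R - Units R)"
  using assms by (auto simp: paragon_rel_Units_iff Units_closed)

lemma zero_not_unit: "\<zero> \<notin> Units R"
  using Units_xor[of \<one>] by (simp add: minus_eq r_neg)

lemma quotient_Units:
  "carrier R // paragon_rel (ring_truss R) (Units R) = {Units R, carrier R - Units R}"
proof -
  have "carrier R // paragon_rel (ring_truss R) (Units R) =
      (\<lambda>x. if x \<in> Units R then Units R else carrier R - Units R) ` carrier R"
    unfolding quotient_def UNION_singleton_eq_range
    by (rule image_cong[OF refl paragon_rel_Units_class])
  also have "\<dots> = {Units R, carrier R - Units R}"
  proof
    show "{Units R, carrier R - Units R} \<subseteq>
        (\<lambda>x. if x \<in> Units R then Units R else carrier R - Units R) ` carrier R"
      \<comment> \<open>The two classes are attained at \<open>\<one>\<close> and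
        \<open>\<zero>\<close>.\<close>
      using zero_not_unit
      by (auto intro: rev_image_eqI[OF one_closed] rev_image_eqI[OF zero_closed])
  qed auto
  finally show ?thesis .
qed

text \<open>This is the isomorphism onto \<int> mod 2, with integer values because
  \<open>residue_ring 2\<close> lives on integers. Among the classes, only that of the nonunits
  falls under the default value 0.\<close>

definition class_parity :: "'a set \<Rightarrow> int"
  where "class_parity A = (if A = Units R then 1 else 0)"

lemma class_parity_class:
  assumes "x \<in> carrier R"
  shows "class_parity (paragon_rel (ring_truss R) (Units R) `` {x}) = of_bool (x \<in> Units R)"
  using assms Units_one_closed by (auto simp: class_parity_def paragon_rel_Units_class)

lemma class_parity_iso:
  "class_parity \<in> truss_iso (quotient_truss (ring_truss R) (Units R)) (ring_truss (residue_ring 2))"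
proof -
  let ?E = "paragon_rel (ring_truss R) (Units R)" and ?Z = "residue_ring 2 :: int ring"
  interpret Z: residues 2 ?Z
    by (simp add: residues_def)
  have ne: "carrier R - Units R \<noteq> Units R"
    using Units_one_closed by blast
  have bij: "bij_betw class_parity (carrier R // ?E) (carrier ?Z)"
    using ne by (auto simp: bij_betw_def inj_on_def quotient_Units class_parity_def Z.res_carrier_eq)
  have rep: "\<exists>x\<in>carrier R. A = ?E `` {x}"
    if "A \<in> carrier (quotient_truss (ring_truss R) (Units R))" for A
    using that by (auto simp: quotient_truss_simps quotient_def)
  \<comment> \<open>The union defining the operation is constant, since the parity of the result
    depends only on the parities of the arguments.\<close>
  have heap: "heap_op (quotient_truss (ring_truss R) (Units R)) (?E `` {x}) (?E `` {y}) (?E `` {z})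
      = ?E `` {x \<ominus> y \<oplus> z}" if "x \<in> carrier R" "y \<in> carrier R" "z \<in> carrier R" for x y z
  proof -
    have "?E `` {a \<ominus> b \<oplus> c} = ?E `` {x \<ominus> y \<oplus> z}"
      if "a \<in> ?E `` {x}" "b \<in> ?E `` {y}" "c \<in> ?E `` {z}" for a b c
      using that
      by (simp add: paragon_rel_Units_iff paragon_rel_Units_class Units_add_iff Units_diff_iff)
    \<comment> \<open>A union of a constant family equals that constant once the index set is
      nonempty.\<close>
    moreover have xyz: "x \<in> ?E `` {x}" "y \<in> ?E `` {y}" "z \<in> ?E `` {z}"
      using that by (simp_all add: paragon_rel_Units_iff)
    ultimately show ?thesis
      unfolding quotient_truss_simps ring_truss_simps
      by (intro ballI UN_constant_eq[OF xyz(1)] UN_constant_eq[OF xyz(2)] UN_constant_eq[OF xyz(3)])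
  qed
  have mult: "truss_mult (quotient_truss (ring_truss R) (Units R)) (?E `` {x}) (?E `` {y})
      = ?E `` {x \<otimes> y}" if "x \<in> carrier R" "y \<in> carrier R" for x y
  proof -
    have "?E `` {a \<otimes> b} = ?E `` {x \<otimes> y}" if "a \<in> ?E `` {x}" "b \<in> ?E `` {y}" for a b
      using that by (simp add: paragon_rel_Units_iff paragon_rel_Units_class Units_mult_iff)
    moreover have xy: "x \<in> ?E `` {x}" "y \<in> ?E `` {y}"
      using that by (simp_all add: paragon_rel_Units_iff)
    ultimately show ?thesis
      unfolding quotient_truss_simps ring_truss_simps
      by (intro ballI UN_constant_eq[OF xy(1)] UN_constant_eq[OF xy(2)])
  qed
  show ?thesis
    unfolding truss_iso_def mem_Collect_eq
  proof (intro conjI ballI)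
    show "bij_betw class_parity (carrier (quotient_truss (ring_truss R) (Units R)))
        (carrier (ring_truss ?Z))"
      using bij by (simp add: quotient_truss_simps)
  next
    fix A B C
    assume "A \<in> carrier (quotient_truss (ring_truss R) (Units R))"
      "B \<in> carrier (quotient_truss (ring_truss R) (Units R))"
      "C \<in> carrier (quotient_truss (ring_truss R) (Units R))"
    then obtain x y z where xyz: "x \<in> carrier R" "y \<in> carrier R" "z \<in> carrier R"
      and ABC: "A = ?E `` {x}" "B = ?E `` {y}" "C = ?E `` {z}"
      by (meson rep)
    show "class_parity (heap_op (quotient_truss (ring_truss R) (Units R)) A B C) =
        heap_op (ring_truss ?Z) (class_parity A) (class_parity B) (class_parity C)"
      \<comment> \<open>On representatives, what remains is arithmetic of unit indicators modulo
        2.\<close>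
      unfolding ABC heap[OF xyz] using xyz
      by (simp add: class_parity_class Units_add_iff Units_minus_iff a_minus_def
          Z.res_neg_eq Z.res_add_eq of_bool_def)
  next
    fix A B
    assume "A \<in> carrier (quotient_truss (ring_truss R) (Units R))"
      "B \<in> carrier (quotient_truss (ring_truss R) (Units R))"
    then obtain x y where xy: "x \<in> carrier R" "y \<in> carrier R"
      and AB: "A = ?E `` {x}" "B = ?E `` {y}"
      by (meson rep)
    show "class_parity (truss_mult (quotient_truss (ring_truss R) (Units R)) A B) =
        truss_mult (ring_truss ?Z) (class_parity A) (class_parity B)"
      unfolding AB mult[OF xy] using xy
      by (simp add: class_parity_class Units_mult_iff Z.res_mult_eq of_bool_def)
  qed
qed

end

theorem theorem3p13:
  fixes R :: "('a, 'm) ring_scheme"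
  assumes "ring R"
  shows "(paragon (ring_truss R) (Units R) \<and>
          truss_isomorphic (quotient_truss (ring_truss R) (Units R)) (ring_truss (residue_ring 2)))
     \<longleftrightarrow> (\<forall>r\<in>carrier R. (r \<in> Units R) \<noteq> (\<one>\<^bsub>R\<^esub> \<ominus>\<^bsub>R\<^esub> r \<in> Units R))"
proof
  interpret ring R by fact
  assume *: "paragon (ring_truss R) (Units R) \<and>
    truss_isomorphic (quotient_truss (ring_truss R) (Units R)) (ring_truss (residue_ring 2))"
  \<comment> \<open>The carrier of \<open>residue_ring 2\<close> is \<open>{0..1}\<close>, so the
    bijection counts two classes.\<close>
  then obtain f where "bij_betw f (carrier R // paragon_rel (ring_truss R) (Units R)) {0..1::int}"
    by (auto simp: truss_isomorphic_def truss_iso_def quotient_truss_simps residue_ring_def)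
  then have "card (carrier R // paragon_rel (ring_truss R) (Units R)) = 2"
    by (simp add: bij_betw_same_card)
  moreover have "sub_heap (ring_truss R) (Units R)"
    using * by (simp add: paragon_def)
  ultimately show "\<forall>r\<in>carrier R. (r \<in> Units R) \<noteq> (\<one>\<^bsub>R\<^esub> \<ominus>\<^bsub>R\<^esub> r \<in> Units R)"
    using Units_xor_if_two_classes by blast
next
  assume "\<forall>r\<in>carrier R. (r \<in> Units R) \<noteq> (\<one>\<^bsub>R\<^esub> \<ominus>\<^bsub>R\<^esub> r \<in> Units R)"
  then interpret complementary_units_ring R
    using assms by (intro complementary_units_ring.intro complementary_units_ring_axioms.intro) auto
  show "paragon (ring_truss R) (Units R) \<and>
    truss_isomorphic (quotient_truss (ring_truss R) (Units R)) (ring_truss (residue_ring 2))"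
    using paragon_Units class_parity_iso by (auto simp: truss_isomorphic_def)
qed

end
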